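(* Problem (FB) has the following properties. (i) If $(X,Y,S)$ is a global minimizer of (FB), then $\mathbb{I}_X=\mathbb{I}_Y$. (ii) $(\bar X,\bar Y,\bar S)$ is a local minimizer of (FB) if and only if it is a local minimizer of $(X,Y,S)\mapsto f(XY^{\mathbb{T}},S)$ on $\underline{\mathcal{B}}^X_{\mathbb{I}_{\bar X}}\times\underline{\mathcal{B}}^Y_{\mathbb{I}_{\bar Y}}\times\underline{\mathcal{B}}^S_{\mathbb{J}_{\bar S}}$. (iii) If $(\bar X,\bar Y,\bar S)$ is a local minimizer of (FB), then there exists $(H_Z,H_S)\in\partial f(\bar X\bar Y^{\mathbb{T}},\bar S)$ (where $\partial f$ is the limiting subdifferential of $f$ as a function of $(Z,S)$, evaluated at $(Z,S)=(\bar X\bar Y^{\mathbb{T}},\bar S)$) such that $$\bm 0\in H_Z\bar Y+N_{\underline{\mathcal{B}}^X_{\mathbb{I}_{\bar X}}}(\bar X),\quad \bm 0\in H_Z^{\mathbb{T}}\bar X+N_{\underline{\mathcal{B}}^Y_{\mathbb{I}_{\bar Y}}}(\bar Y),\quad \bm 0\in H_S+N_{\underline{\mathcal{B}}^S_{\mathbb{J}_{\bar S}}}(\bar S).$$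
   Context: Let $m,n,d$ be positive integers, $\lambda,\beta\ge 0$, $\tau\in[0,+\infty]$, and let $f:\mathbb{R}^{m\times n}\times\mathbb{R}^{m\times n}\to[0,+\infty)$, $(Z,S)\mapsto f(Z,S)$, be locally Lipschitz continuous. $\|S\|_0$ is the number of nonzero entries of $S$; $\mathrm{nnzc}(X)$ the number of nonzero columns of $X$; $U_i$ the $i$-th column of $U$. Let $\mathcal{B}^X:=\{X\in\mathbb{R}^{m\times d}:\|X_i\|_2\le\tau\ \forall i\}$, $\mathcal{B}^Y:=\{Y\in\mathbb{R}^{n\times d}:\|Y_i\|_2\le\tau\ \forall i\}$, and $\mathcal{B}^S:=\{S\in\mathbb{R}^{m\times n}:\kappa^1_{ij}\le S_{ij}\le\kappa^2_{ij}\ \forall i,j\}$ with given $\kappa^1_{ij}\in[-\infty,0]$, $\kappa^2_{ij}\in[0,+\infty]$. Problem (FB): minimize $F(X,Y,S):=f(XY^{\mathbb{T}},S)+\lambda(\mathrm{nnzc}(X)+\mathrm{nnzc}(Y))+\beta\|S\|_0$ over $(X,Y,S)\in\mathcal{B}^X\times\mathcal{B}^Y\times\mathcal{B}^S$. Index sets: for $U\in\mathbb{R}^{p\times d}$, $\mathbb{I}_U:=\{i\in[d]:U_i\ne\bm 0\}$ if $\lambda>0$, and $\mathbb{I}_U:=[d]$ if $\lambda=0$. For $S\in\mathbb{R}^{m\times n}$, $\mathbb{J}_S:=\{(i,j):S_{ij}\neq0\}$ if $\beta>0$, and $\mathbb{J}_S:=[m]\times[n]$ if $\beta=0$. For $\mathbb{I}\subseteq[d]$,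 $\underline{\mathcal{B}}^X_{\mathbb{I}}$ (resp. $\underline{\mathcal{B}}^Y_{\mathbb{I}}$) is the set of matrices obtained from elements of $\mathcal{B}^X$ (resp. $\mathcal{B}^Y$) by setting to zero all columns outside $\mathbb{I}$; for $\mathbb{J}\subseteq[m]\times[n]$, $\underline{\mathcal{B}}^S_{\mathbb{J}}$ is obtained from $\mathcal{B}^S$ by setting to zero all entries outside $\mathbb{J}$. $\partial$ is the limiting (Mordukhovich) subdifferential and $N_\Omega(\cdot)$ the limiting normal cone, in the sense of Rockafellar–Wets. *)

theory Defs
  imports "HOL-Analysis.Analysis" "HOL-Library.Set_Algebras"
begin

section \<open>Variational analysis\<close>

text \<open>The parametrised library notion \<^const>\<open>local_lipschitz\<close> is Lipschitz only in its last
  argument; below, Lipschitz continuity is meant jointly in the whole argument.\<close>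

definition locally_lipschitz :: "('a::metric_space \<Rightarrow> 'b::metric_space) \<Rightarrow> bool" where
  "locally_lipschitz f \<longleftrightarrow> (\<forall>x. \<exists>r>0. \<exists>L. L-lipschitz_on (ball x r) f)"

definition local_minimizer_on :: "('a::metric_space \<Rightarrow> real) \<Rightarrow> 'a set \<Rightarrow> 'a \<Rightarrow> bool" where
  "local_minimizer_on g \<Omega> x \<longleftrightarrow> x \<in> \<Omega> \<and> (\<exists>r>0. \<forall>y\<in>\<Omega> \<inter> ball x r. g x \<le> g y)"

text \<open>Regular and general (limiting) subgradients and normals in the sense of Rockafellar and
  Wets, Variational Analysis, Definitions 8.3 and 6.3, for functions that are finite everywhere.
  On matrices \<^typ>\<open>real^'n^'m\<close> and on pairs of matrices the library inner product is the
  Frobenius one, and the norm is the Frobenius norm.\<close>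

definition regular_subdifferential :: "('a::real_inner \<Rightarrow> real) \<Rightarrow> 'a \<Rightarrow> 'a set" where
  "regular_subdifferential f x =
     {v. 0 \<le> Liminf (at x) (\<lambda>y. ereal ((f y - f x - v \<bullet> (y - x)) / norm (y - x)))}"

definition limiting_subdifferential :: "('a::real_inner \<Rightarrow> real) \<Rightarrow> 'a \<Rightarrow> 'a set" where
  "limiting_subdifferential f x =
     {v. \<exists>xs vs. xs \<longlonglongrightarrow> x \<and> (\<lambda>k. f (xs k)) \<longlonglongrightarrow> f x \<and>
                 (\<forall>k::nat. vs k \<in> regular_subdifferential f (xs k)) \<and> vs \<longlonglongrightarrow> v}"

text \<open>Normal vectors are only considered at points of \<open>\<Omega>\<close>; both cones are empty elsewhere.\<close>

definition regular_normal_cone :: "'a::real_inner set \<Rightarrow> 'a \<Rightarrow> 'a set" where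
  "regular_normal_cone \<Omega> x =
     {v. x \<in> \<Omega> \<and> Limsup (at x within \<Omega>) (\<lambda>y. ereal ((v \<bullet> (y - x)) / norm (y - x))) \<le> 0}"

definition limiting_normal_cone :: "'a::real_inner set \<Rightarrow> 'a \<Rightarrow> 'a set" where
  "limiting_normal_cone \<Omega> x =
     {v. x \<in> \<Omega> \<and> (\<exists>xs vs. (\<forall>k::nat. xs k \<in> \<Omega>) \<and> xs \<longlonglongrightarrow> x \<and>
                 (\<forall>k. vs k \<in> regular_normal_cone \<Omega> (xs k)) \<and> vs \<longlonglongrightarrow> v)}"


section \<open>The factorised problem\<close>

text \<open>A \<open>p \<times> q\<close> matrix is an element of \<^typ>\<open>real^'q^'p\<close>, with entry \<open>(i, j)\<close> being \<open>A $ i $ j\<close>.\<close>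

definition nnzc :: "real^'d^'p \<Rightarrow> nat" where
  "nnzc U = card {i. column i U \<noteq> 0}"

definition l0_norm :: "real^'n^'m \<Rightarrow> nat" where
  "l0_norm S = card {(i, j). S $ i $ j \<noteq> 0}"

definition column_ball :: "ereal \<Rightarrow> (real^'d^'p) set" where
  "column_ball \<tau> = {U. \<forall>i. ereal (norm (column i U)) \<le> \<tau>}"

definition entry_box :: "('m \<Rightarrow> 'n \<Rightarrow> ereal) \<Rightarrow> ('m \<Rightarrow> 'n \<Rightarrow> ereal) \<Rightarrow> (real^'n^'m) set" where
  "entry_box \<kappa>1 \<kappa>2 = {S. \<forall>i j. \<kappa>1 i j \<le> ereal (S $ i $ j) \<and> ereal (S $ i $ j) \<le> \<kappa>2 i j}"

definition FB_objective ::
  "((real^'n^'m) \<times> (real^'n^'m) \<Rightarrow> real) \<Rightarrow> real \<Rightarrow> real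
     \<Rightarrow> (real^'d^'m) \<times> (real^'d^'n) \<times> (real^'n^'m) \<Rightarrow> real" where
  "FB_objective f lam \<beta> = (\<lambda>(X, Y, S).
     f (X ** transpose Y, S) + lam * (real (nnzc X) + real (nnzc Y)) + \<beta> * real (l0_norm S))"

definition FB_feasible ::
  "ereal \<Rightarrow> ('m \<Rightarrow> 'n \<Rightarrow> ereal) \<Rightarrow> ('m \<Rightarrow> 'n \<Rightarrow> ereal)
     \<Rightarrow> ((real^'d^'m) \<times> (real^'d^'n) \<times> (real^'n^'m)) set" where
  "FB_feasible \<tau> \<kappa>1 \<kappa>2 = column_ball \<tau> \<times> column_ball \<tau> \<times> entry_box \<kappa>1 \<kappa>2"

definition col_index_set :: "real \<Rightarrow> real^'d^'p \<Rightarrow> 'd set" where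
  "col_index_set lam U = (if lam > 0 then {i. column i U \<noteq> 0} else UNIV)"

definition entry_index_set :: "real \<Rightarrow> real^'n^'m \<Rightarrow> ('m \<times> 'n) set" where
  "entry_index_set \<beta> S = (if \<beta> > 0 then {(i, j). S $ i $ j \<noteq> 0} else UNIV)"

definition zero_cols_outside :: "'d set \<Rightarrow> real^'d^'p \<Rightarrow> real^'d^'p" where
  "zero_cols_outside I U = (\<chi> i j. if j \<in> I then U $ i $ j else 0)"

definition zero_entries_outside :: "('m \<times> 'n) set \<Rightarrow> real^'n^'m \<Rightarrow> real^'n^'m" where
  "zero_entries_outside J S = (\<chi> i j. if (i, j) \<in> J then S $ i $ j else 0)"

definition restricted_column_ball :: "ereal \<Rightarrow> 'd set \<Rightarrow> (real^'d^'p) set" where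
  "restricted_column_ball \<tau> I = zero_cols_outside I ` column_ball \<tau>"

definition restricted_entry_box ::
  "('m \<Rightarrow> 'n \<Rightarrow> ereal) \<Rightarrow> ('m \<Rightarrow> 'n \<Rightarrow> ereal) \<Rightarrow> ('m \<times> 'n) set \<Rightarrow> (real^'n^'m) set" where
  "restricted_entry_box \<kappa>1 \<kappa>2 J = zero_entries_outside J ` entry_box \<kappa>1 \<kappa>2"

end

theory Submission
  imports Defs
begin

text \<open>For (i), zeroing a column of one factor whose partner column vanishes leaves the product unchanged
  and lowers the penalty. For (ii), the supports of nearby points can only grow; off the restricted set
  the penalty jumps by a fixed amount, which the continuity of \<open>f\<close> cannot compensate. For (iii), by (ii)
  the point is a local minimizer of \<open>f \<circ> G\<close> on a closed convex set, where \<open>G (X, Y, S) = (X Y\<^sup>T, S)\<close>.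
  Instead of a general chain rule, one minimizes
  \<open>f z + k/2 \<bar>z - G x\<bar>\<^sup>2 + 1/2 \<bar>x - x0\<bar>\<^sup>2\<close> near \<open>(x0, G x0)\<close>; the vectors \<open>k (G x - z)\<close> are regular subgradients
  bounded by twice the Lipschitz constant, and a cluster point as \<open>k \<rightarrow> \<infinity>\<close> is the multiplier.\<close>

section \<open>First-order conditions for composite problems\<close>

text \<open>After division by \<open>norm (y - x)\<close> the quadratic error becomes
  \<open>C * norm (y - x)\<close>, which vanishes in the limit. Expanding a squared penalty produces
  exactly such a bound.\<close>

lemma regular_subgradientI:
  assumes "0 < \<delta>" and "\<And>y. y \<in> ball x \<delta> \<Longrightarrow> v \<bullet> (y - x) - C * (norm (y - x))\<^sup>2 \<le> f y - f x"
  shows "v \<in> regular_subdifferential f x"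
  unfolding regular_subdifferential_def mem_Collect_eq le_Liminf_iff
proof (intro allI impI)
  fix c :: ereal
  assume c: "c < 0"
  obtain e where e: "0 < e" "c \<le> ereal (- e)"
  proof (cases c)
    case (real r)
    then show ?thesis using c that[of "- r"] by auto
  qed (use c that[of 1] in auto)
  \<comment> \<open>Within this radius \<open>\<bar>C\<bar> * norm (y - x)\<close> stays below
    \<open>e\<close>; the \<open>+ 1\<close> covers \<open>C = 0\<close>.\<close>
  define \<eta> where "\<eta> = min \<delta> (e / (\<bar>C\<bar> + 1))"
  have "0 < \<eta>" using assms(1) e(1) by (simp add: \<eta>_def)
  moreover have "- e < (f y - f x - v \<bullet> (y - x)) / norm (y - x)" if "y \<noteq> x" "dist y x < \<eta>" for y
  proof -
    have n: "0 < norm (y - x)" "norm (y - x) < e / (\<bar>C\<bar> + 1)" "y \<in> ball x \<delta>"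
      using that by (auto simp: \<eta>_def dist_norm norm_minus_commute)
    have "C * norm (y - x) \<le> \<bar>C\<bar> * norm (y - x)" by (intro mult_right_mono) auto
    also have "\<dots> \<le> (\<bar>C\<bar> + 1) * norm (y - x)" by (intro mult_right_mono) auto
    also have "\<dots> < e" using n(2) by (simp add: field_simps)
    finally have "- e * norm (y - x) < - C * (norm (y - x))\<^sup>2"
      using n(1) by (simp add: power2_eq_square)
    also have "\<dots> \<le> f y - f x - v \<bullet> (y - x)" using assms(2)[OF n(3)] by simp
    finally show ?thesis using n(1) by (simp add: field_simps)
  qed
  ultimately show "\<forall>\<^sub>F y in at x. c < ereal ((f y - f x - v \<bullet> (y - x)) / norm (y - x))"
    unfolding eventually_at using e(2) by (metis le_less_trans less_ereal.simps(1) UNIV_I)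
qed

text \<open>All difference quotients are nonpositive, so \<open>v\<close> is a regular normal, and
  constant sequences make it a limiting one.\<close>

lemma limiting_normalI:
  assumes "x \<in> \<Omega>" and "\<And>y. y \<in> \<Omega> \<Longrightarrow> v \<bullet> (y - x) \<le> 0"
  shows "v \<in> limiting_normal_cone \<Omega> x"
proof -
  have "\<forall>\<^sub>F y in at x within \<Omega>. ereal ((v \<bullet> (y - x)) / norm (y - x)) \<le> 0"
    using assms(2) by (auto simp: eventually_at_filter divide_nonpos_nonneg)
  then have "v \<in> regular_normal_cone \<Omega> x"
    using assms(1) by (simp add: regular_normal_cone_def Limsup_bounded)
  then show ?thesis
    using assms(1) unfolding limiting_normal_cone_def mem_Collect_eq
    by (intro conjI exI[where x = "\<lambda>_. x"] exI[where x = "\<lambda>_. v"]) auto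
qed

lemma locally_lipschitz_continuous:
  assumes "locally_lipschitz f"
  shows "isCont f x"
proof -
  obtain r L where "0 < r" "L-lipschitz_on (ball x r) f"
    using assms unfolding locally_lipschitz_def by blast
  then have "continuous_on (ball x r) f" by (simp add: lipschitz_on_continuous_on)
  then show ?thesis using \<open>0 < r\<close> continuous_on_interior by fastforce
qed

text \<open>The quadratic coupling penalty decouples the outer function from the inner map: stationarity
  in \<open>z\<close> yields a regular subgradient at \<open>z\<close>, stationarity in \<open>x\<close> the variational inequality.
  The bound on \<open>v\<close> does not depend on the penalty parameter.\<close>

lemma approximate_multiplier:
  fixes f :: "'b::euclidean_space \<Rightarrow> real" and G :: "'a::euclidean_space \<Rightarrow> 'b"
  assumes "closed \<Omega>" and "convex \<Omega>"
    and "0 < r" and lip: "L-lipschitz_on (ball (G x0) r) f"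
    and der: "\<And>x. (G has_derivative G' x) (at x)"
    and min: "local_minimizer_on (\<lambda>x. f (G x)) \<Omega> x0"
    and "0 < e"
  obtains x z v where "x \<in> \<Omega>" "dist x x0 < e" "dist z (G x0) < e"
    "v \<in> regular_subdifferential f z" "norm v \<le> 2 * L"
    "\<And>y. y \<in> \<Omega> \<Longrightarrow> 0 \<le> v \<bullet> G' x (y - x) + (x - x0) \<bullet> (y - x)"
proof -
  have L: "0 \<le> L" using lip by (rule lipschitz_on_nonneg)
  have x0: "x0 \<in> \<Omega>" using min by (simp add: local_minimizer_on_def)
  obtain r1 where r1: "0 < r1" "\<And>y. y \<in> \<Omega> \<Longrightarrow> dist x0 y < r1 \<Longrightarrow> f (G x0) \<le> f (G y)"
    using min by (auto simp: local_minimizer_on_def)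
  have contG: "continuous_on A G" for A
    using der by (meson continuous_at_imp_continuous_on has_derivative_continuous)
  \<comment> \<open>The closed \<open>\<sigma>\<close>-ball around \<open>G x0\<close> lies in the
    ball where \<open>f\<close> is Lipschitz and within distance \<open>e\<close>.\<close>
  define \<sigma> where "\<sigma> = min r e / 2"
  have \<sigma>: "0 < \<sigma>" "\<sigma> < r" "\<sigma> < e" using assms by (auto simp: \<sigma>_def)
  \<comment> \<open>\<open>G x\<close> uses up at most half of \<open>\<sigma>\<close>; the other
    half is left for the distance from \<open>z\<close> to \<open>G x\<close>.\<close>
  obtain \<rho>0 where \<rho>0: "0 < \<rho>0" "\<And>x. dist x x0 < \<rho>0 \<Longrightarrow> dist (G x) (G x0) < \<sigma> / 2"
    using contG[of UNIV] \<sigma>(1) unfolding continuous_on_iff by (metis UNIV_I half_gt_zero)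
  define \<rho> where "\<rho> = min (min \<rho>0 r1) e / 2"
  have \<rho>: "0 < \<rho>" "\<rho> < r1" "\<rho> < e" "\<rho> < \<rho>0" using assms(7) r1 \<rho>0 by (auto simp: \<rho>_def)
  \<comment> \<open>The second and third summands will force the minimizer strictly inside the
    \<open>\<rho>\<close>-ball and the \<open>\<sigma>\<close>-ball respectively; the
    \<open>1\<close> keeps \<open>k\<close> positive when \<open>L = 0\<close>.\<close>
  define k where "k = 1 + 4 * L\<^sup>2 / \<rho>\<^sup>2 + 4 * L / \<sigma>"
  have k: "0 < k" "4 * L\<^sup>2 / \<rho>\<^sup>2 < k" "4 * L / \<sigma> < k"
    using L \<sigma> \<rho> by (auto simp: k_def add_pos_nonneg add_nonneg_pos)
  define \<phi> where "\<phi> = (\<lambda>(x, z). f z + k / 2 * ((z - G x) \<bullet> (z - G x)) + ((x - x0) \<bullet> (x - x0)) / 2)"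
  define K where "K = (\<Omega> \<inter> cball x0 \<rho>) \<times> cball (G x0) \<sigma>"
  have "compact K"
    unfolding K_def using assms(1) by (intro compact_Times closed_Int_compact) auto
  moreover have K0: "(x0, G x0) \<in> K" using x0 \<rho> \<sigma> by (simp add: K_def)
  moreover have "continuous_on K \<phi>"
  proof -
    have "continuous_on (cball (G x0) \<sigma>) f"
      using lipschitz_on_continuous_on[OF lip] by (rule continuous_on_subset) (use \<sigma> in auto)
    then have "continuous_on K (\<lambda>p. f (snd p))"
      by (rule continuous_on_compose2) (auto simp: K_def intro!: continuous_intros)
    moreover have "continuous_on K (\<lambda>p. G (fst p))"
      by (rule continuous_on_compose2[OF contG[of UNIV]]) (auto intro!: continuous_intros)
    ultimately show ?thesis
      unfolding \<phi>_def case_prod_beta by (intro continuous_intros) auto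
  qed
  ultimately obtain p where "p \<in> K" and "\<forall>q\<in>K. \<phi> p \<le> \<phi> q"
    using continuous_attains_inf[of K \<phi>] by blast
  then obtain x z where xz: "(x, z) \<in> K" and opt: "\<And>q. q \<in> K \<Longrightarrow> \<phi> (x, z) \<le> \<phi> q"
    by (cases p) auto
  define v where "v = k *\<^sub>R (G x - z)"
  define d where "d = norm (z - G x)"
  have x: "x \<in> \<Omega>" "dist x x0 \<le> \<rho>" and z: "dist z (G x0) \<le> \<sigma>"
    using xz by (auto simp: K_def dist_commute)
  have Gx: "dist (G x) (G x0) < \<sigma> / 2" using \<rho>0(2) x(2) \<rho>(4) by auto
  \<comment> \<open>Compare the minimum with the value at \<open>(x0, G x0)\<close>, use local
    minimality of \<open>x0\<close> against \<open>x\<close>, and pass from \<open>G x\<close> to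
    \<open>z\<close> by the Lipschitz bound.\<close>
  have est: "k / 2 * d\<^sup>2 + (dist x x0)\<^sup>2 / 2 \<le> L * d"
  proof -
    have "f z + k / 2 * d\<^sup>2 + (dist x x0)\<^sup>2 / 2 \<le> f (G x0)"
      using opt[OF K0] by (simp add: \<phi>_def d_def dist_norm power2_norm_eq_inner)
    also have "\<dots> \<le> f (G x)" using r1(2)[OF x(1)] x(2) \<rho> by (simp add: dist_commute)
    also have "\<dots> \<le> f z + L * d"
    proof -
      have "dist (f (G x)) (f z) \<le> L * dist (G x) z"
        using Gx z \<sigma> by (intro lipschitz_onD[OF lip]) (auto simp: dist_commute)
      then show ?thesis by (auto simp: d_def dist_norm norm_minus_commute)
    qed
    finally show ?thesis by simp
  qed
  \<comment> \<open>Dropping the proximal term and dividing by \<open>d\<close> gives the bound on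
    \<open>norm v\<close>, which equals \<open>k * d\<close>.\<close>
  have kd: "k * d \<le> 2 * L"
  proof (cases "d = 0")
    case False
    then have "0 < d" by (simp add: d_def)
    moreover have "(k * d) * d \<le> (2 * L) * d"
      using est zero_le_power2[of "dist x x0"] unfolding power2_eq_square by argo
    ultimately show ?thesis by simp
  qed (use L in auto)
  then have d: "d \<le> 2 * L / k" using k(1) by (simp add: field_simps)
  \<comment> \<open>Strictness here and for \<open>z\<close> makes the ball constraints of
    \<open>K\<close> inactive, so small variations of \<open>x\<close> within
    \<open>\<Omega>\<close> and of \<open>z\<close> remain admissible.\<close>
  have "dist x x0 < \<rho>"
  proof -
    have "(dist x x0)\<^sup>2 \<le> 2 * (L * d)"
      using est k(1) zero_le_power2[of d] by (smt (verit) mult_nonneg_nonneg divide_nonneg_pos field_sum_of_halves)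
    also have "\<dots> \<le> 2 * (L * (2 * L / k))" using d L by (intro mult_left_mono) auto
    also have "\<dots> = 4 * L\<^sup>2 / k" by (simp add: power2_eq_square)
    also have "\<dots> < \<rho>\<^sup>2" using k(1,2) \<rho>(1) by (simp add: field_simps)
    finally show ?thesis using \<rho>(1) by (simp add: power_less_imp_less_base)
  qed
  have "dist z (G x0) < \<sigma>"
  proof -
    have "k * (2 * d) < k * \<sigma>" using kd k(3) \<sigma>(1) by (simp add: field_simps)
    then have "d < \<sigma> / 2" using k(1) by simp
    then show ?thesis
      using Gx dist_triangle[of z "G x0" "G x"] by (simp add: d_def dist_norm)
  qed
  have "v \<in> regular_subdifferential f z"
  proof (rule regular_subgradientI)
    show "0 < \<sigma> - dist z (G x0)" using \<open>dist z (G x0) < \<sigma>\<close> by simp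
  next
    fix y assume "y \<in> ball z (\<sigma> - dist z (G x0))"
    then have "dist (G x0) y \<le> \<sigma>"
      using dist_triangle[of "G x0" y z] by (simp add: dist_commute)
    then have "\<phi> (x, z) \<le> \<phi> (x, y)" using x by (intro opt) (simp add: K_def dist_commute)
    \<comment> \<open>With \<open>x\<close> fixed, expanding the square around \<open>z\<close>
      leaves the linear term \<open>v \<bullet> (y - z)\<close> and the remainder
      \<open>k / 2 * (norm (y - z))\<^sup>2\<close>.\<close>
    then show "v \<bullet> (y - z) - k / 2 * (norm (y - z))\<^sup>2 \<le> f y - f z"
      unfolding \<phi>_def v_def power2_norm_eq_inner
      by (simp add: inner_diff_left inner_diff_right inner_commute algebra_simps)
  qed
  moreover have "0 \<le> v \<bullet> G' x (y - x) + (x - x0) \<bullet> (y - x)" if "y \<in> \<Omega>" for y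
  proof (rule ccontr)
    define c where "c = (\<lambda>t. x + t *\<^sub>R (y - x))"
    \<comment> \<open>With \<open>z\<close> fixed only the two quadratic terms vary. A negative
      slope \<open>D\<close> along the segment towards \<open>y\<close> would decrease
      \<open>\<phi>\<close> at a feasible point.\<close>
    define \<psi> where "\<psi> = (\<lambda>t. k / 2 * ((z - G (c t)) \<bullet> (z - G (c t))) + 1 / 2 * ((c t - x0) \<bullet> (c t - x0)))"
    define D where "D = v \<bullet> G' x (y - x) + (x - x0) \<bullet> (y - x)"
    assume "\<not> 0 \<le> v \<bullet> G' x (y - x) + (x - x0) \<bullet> (y - x)"
    then have "D < 0" by (simp add: D_def)
    have lin: "bounded_linear (G' x)" using der by (rule has_derivative_bounded_linear)
    have dc: "(c has_derivative (\<lambda>t. t *\<^sub>R (y - x))) (at 0)"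
      unfolding c_def by (auto intro!: derivative_eq_intros)
    have dG: "((\<lambda>t. G (c t)) has_derivative (\<lambda>t. t *\<^sub>R G' x (y - x))) (at 0)"
      using has_derivative_compose[OF dc, of G "G' x"] der[of x] linear_cmul[OF bounded_linear.linear[OF lin]]
      by (simp add: c_def)
    have "(\<psi> has_derivative (\<lambda>t. D * t)) (at 0)"
      unfolding \<psi>_def
      by (rule derivative_eq_intros dc dG refl)+
         (simp add: fun_eq_iff D_def v_def c_def inner_commute algebra_simps inner_diff_left inner_diff_right)
    then have "(\<psi> has_real_derivative D) (at 0)" by (simp add: has_field_derivative_def)
    then obtain h0 where h0: "0 < h0" "\<And>h. 0 < h \<Longrightarrow> h < h0 \<Longrightarrow> \<psi> h < \<psi> 0"
      using has_real_derivative_neg_dec_right[of \<psi> D 0 UNIV] \<open>D < 0\<close> by auto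
    \<comment> \<open>The three bounds serve, in turn, convexity, the strict decrease of
      \<open>\<psi>\<close>, and staying in the \<open>\<rho>\<close>-ball; the \<open>+ 1\<close>
      covers \<open>y = x\<close>.\<close>
    define h where "h = min (min 1 (h0 / 2)) ((\<rho> - dist x x0) / (2 * (norm (y - x) + 1)))"
    have h: "0 < h" "h \<le> 1" "h < h0" "h \<le> (\<rho> - dist x x0) / (2 * (norm (y - x) + 1))"
      using h0(1) \<open>dist x x0 < \<rho>\<close> unfolding h_def
      by (auto simp: min_less_iff_disj add_nonneg_pos intro!: divide_pos_pos)
    have "c h \<in> \<Omega>"
      using convexD_alt[OF assms(2) x(1) that, of h] h by (simp add: c_def algebra_simps)
    moreover have "dist x0 (c h) \<le> \<rho>"
    proof -
      have "h * norm (y - x) \<le> h * (2 * (norm (y - x) + 1))" using h(1) by (intro mult_left_mono) auto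
      also have "\<dots> \<le> \<rho> - dist x x0"
        using h(4) by (simp add: pos_le_divide_eq add_nonneg_pos)
      finally have "dist x (c h) \<le> \<rho> - dist x x0"
        using h(1) by (simp add: c_def dist_norm)
      then show ?thesis using dist_triangle[of x0 "c h" x] by (simp add: dist_commute)
    qed
    ultimately have "\<phi> (x, z) \<le> \<phi> (c h, z)"
      using z by (intro opt) (simp add: K_def dist_commute)
    then have "\<psi> 0 \<le> \<psi> h" by (simp add: \<phi>_def \<psi>_def c_def)
    then show False using h0(2)[OF h(1,3)] by simp
  qed
  moreover have "norm v \<le> 2 * L"
    using kd k(1) by (simp add: v_def d_def norm_minus_commute)
  moreover have "dist x x0 < e" "dist z (G x0) < e" using \<open>dist x x0 < \<rho>\<close> \<open>dist z (G x0) < \<sigma>\<close> \<rho> \<sigma> by auto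
  ultimately show thesis using that x(1) by blast
qed

section \<open>Passage to the limit in the approximate multipliers\<close>

text \<open>The approximate multipliers share the bound \<open>2 * L\<close>, so a subsequence
  converges. Base point and direction of \<open>G'\<close> vary together, hence joint continuity is
  used to pass to the limit.\<close>

lemma composite_multiplier:
  fixes f :: "'b::euclidean_space \<Rightarrow> real" and G :: "'a::euclidean_space \<Rightarrow> 'b"
  assumes "closed \<Omega>" and "convex \<Omega>" and lip: "locally_lipschitz f"
    and der: "\<And>x. (G has_derivative G' x) (at x)"
    and cont: "continuous_on UNIV (\<lambda>(x, h). G' x h)"
    and min: "local_minimizer_on (\<lambda>x. f (G x)) \<Omega> x0"
  obtains H where "H \<in> limiting_subdifferential f (G x0)"
    "\<And>y. y \<in> \<Omega> \<Longrightarrow> 0 \<le> H \<bullet> G' x0 (y - x0)"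
proof -
  obtain r L where r: "0 < r" "L-lipschitz_on (ball (G x0) r) f"
    using lip unfolding locally_lipschitz_def by blast
  have "\<exists>x z v. x \<in> \<Omega> \<and> dist x x0 < inverse (real (Suc n)) \<and> dist z (G x0) < inverse (real (Suc n))
    \<and> v \<in> regular_subdifferential f z \<and> norm v \<le> 2 * L
    \<and> (\<forall>y\<in>\<Omega>. 0 \<le> v \<bullet> G' x (y - x) + (x - x0) \<bullet> (y - x))" for n
    by (rule approximate_multiplier[OF assms(1,2) r der min, where e = "inverse (real (Suc n))"]) auto
  then obtain x z v where
    x: "\<And>n. dist (x n) x0 < inverse (real (Suc n))" and
    z: "\<And>n. dist (z n) (G x0) < inverse (real (Suc n))" and
    v: "\<And>n. v n \<in> regular_subdifferential f (z n)" "\<And>n. norm (v n) \<le> 2 * L" and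
    vi: "\<And>n y. y \<in> \<Omega> \<Longrightarrow> 0 \<le> v n \<bullet> G' (x n) (y - x n) + (x n - x0) \<bullet> (y - x n)"
    by metis
  have lim0: "(\<lambda>n. inverse (real (Suc n))) \<longlonglongrightarrow> 0" by (rule LIMSEQ_inverse_real_of_nat)
  have xlim: "x \<longlonglongrightarrow> x0"
    by (rule tendsto_dist_iff[THEN iffD2], rule tendsto_sandwich[OF _ _ tendsto_const lim0])
       (use x in \<open>auto intro!: always_eventually less_imp_le\<close>)
  have zlim: "z \<longlonglongrightarrow> G x0"
    by (rule tendsto_dist_iff[THEN iffD2], rule tendsto_sandwich[OF _ _ tendsto_const lim0])
       (use z in \<open>auto intro!: always_eventually less_imp_le\<close>)
  have "\<forall>n. v n \<in> cball 0 (2 * L)" using v(2) by simp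
  then obtain H s where s: "strict_mono s" "(v \<circ> s) \<longlonglongrightarrow> H"
    using compact_cball[of "0::'b" "2 * L"] unfolding compact_def by metis
  have xs: "(\<lambda>n. x (s n)) \<longlonglongrightarrow> x0" and zs: "(\<lambda>n. z (s n)) \<longlonglongrightarrow> G x0" and vs: "(\<lambda>n. v (s n)) \<longlonglongrightarrow> H"
    using LIMSEQ_subseq_LIMSEQ[OF xlim s(1)] LIMSEQ_subseq_LIMSEQ[OF zlim s(1)] s(2) by (auto simp: o_def)
  \<comment> \<open>Limiting subgradients also require convergence of the function values, supplied
    by continuity.\<close>
  have "(\<lambda>n. f (z (s n))) \<longlonglongrightarrow> f (G x0)"
    using locally_lipschitz_continuous[OF lip] zs by (rule isCont_tendsto_compose)
  then have "H \<in> limiting_subdifferential f (G x0)"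
    unfolding limiting_subdifferential_def mem_Collect_eq using zs vs v(1)
    by (intro exI[where x = "\<lambda>n. z (s n)"] exI[where x = "\<lambda>n. v (s n)"]) auto
  moreover have "0 \<le> H \<bullet> G' x0 (y - x0)" if "y \<in> \<Omega>" for y
  proof -
    have "isCont (\<lambda>(x, h). G' x h) (x0, y - x0)"
      using cont by (simp add: continuous_on_eq_continuous_at)
    moreover have "(\<lambda>n. (x (s n), y - x (s n))) \<longlonglongrightarrow> (x0, y - x0)"
      using xs by (intro tendsto_intros)
    ultimately have "(\<lambda>n. G' (x (s n)) (y - x (s n))) \<longlonglongrightarrow> G' x0 (y - x0)"
      using isCont_tendsto_compose by fastforce
    \<comment> \<open>The proximal contribution disappears because \<open>x (s n)\<close> tends to
      \<open>x0\<close>.\<close>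
    then have "(\<lambda>n. v (s n) \<bullet> G' (x (s n)) (y - x (s n)) + (x (s n) - x0) \<bullet> (y - x (s n)))
        \<longlonglongrightarrow> H \<bullet> G' x0 (y - x0) + (x0 - x0) \<bullet> (y - x0)"
      using xs vs by (intro tendsto_intros)
    then show ?thesis
      using LIMSEQ_le_const[where a = 0] vi[OF that] by fastforce
  qed
  ultimately show thesis using that by blast
qed

section \<open>Restricted sets and support gaps\<close>

text \<open>In filter form, the finitely many neighbourhoods needed for the equivalence of local
  minimizers combine without explicit radii.\<close>

lemma local_minimizer_on_eventually:
  "local_minimizer_on g \<Omega> x \<longleftrightarrow> x \<in> \<Omega> \<and> (\<forall>\<^sub>F y in nhds x. y \<in> \<Omega> \<longrightarrow> g x \<le> g y)"
  by (auto simp: local_minimizer_on_def eventually_nhds_metric dist_commute)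

lemma column_zero_cols_outside: "column i (zero_cols_outside I U) = (if i \<in> I then column i U else 0)"
  by (simp add: zero_cols_outside_def column_def vec_eq_iff)

lemma matrix_eq_columnI: "(\<And>i. column i A = column i B) \<Longrightarrow> A = B"
  by (simp add: column_def vec_eq_iff)

lemma zero_cols_outside_in_column_ball:
  assumes "0 \<le> \<tau>" and "U \<in> column_ball \<tau>"
  shows "zero_cols_outside I U \<in> column_ball \<tau>"
  using assms by (simp add: column_ball_def column_zero_cols_outside zero_ereal_def)

text \<open>Zeroing columns fixes matrices already supported in \<open>I\<close> and never leaves
  the ball, since \<open>0 \<le> \<tau>\<close>. The image thus becomes a support condition.\<close>

lemma restricted_column_ball_eq:
  assumes "0 \<le> \<tau>"
  shows "restricted_column_ball \<tau> I = {U \<in> column_ball \<tau>. {i. column i U \<noteq> 0} \<subseteq> I}"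
proof -
  have "U = zero_cols_outside I U" if "{i. column i U \<noteq> 0} \<subseteq> I" for U :: "real^'a^'b"
    by (rule matrix_eq_columnI) (use that in \<open>auto simp: column_zero_cols_outside\<close>)
  then show ?thesis
    using zero_cols_outside_in_column_ball[OF assms]
    by (auto simp: restricted_column_ball_def column_zero_cols_outside split: if_splits)
qed

text \<open>The sign conditions put \<open>0\<close> in every interval, so zeroing entries stays in
  the box.\<close>

lemma restricted_entry_box_eq:
  assumes "\<forall>i j. \<kappa>1 i j \<le> 0" and "\<forall>i j. 0 \<le> \<kappa>2 i j"
  shows "restricted_entry_box \<kappa>1 \<kappa>2 J = {S \<in> entry_box \<kappa>1 \<kappa>2. {(i, j). S $ i $ j \<noteq> 0} \<subseteq> J}"
proof -
  have "S = zero_entries_outside J S" if "{(i, j). S $ i $ j \<noteq> 0} \<subseteq> J" for S :: "real^'b^'a"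
    using that by (auto simp: zero_entries_outside_def vec_eq_iff)
  moreover have "zero_entries_outside J S \<in> entry_box \<kappa>1 \<kappa>2" if "S \<in> entry_box \<kappa>1 \<kappa>2" for S
    using that assms by (simp add: zero_entries_outside_def entry_box_def zero_ereal_def)
  ultimately show ?thesis
    by (auto simp: restricted_entry_box_def zero_entries_outside_def split: if_splits)
qed

section \<open>Closedness and convexity of the restricted sets\<close>

lemma linear_column: "linear (column i :: real^'n^'m \<Rightarrow> real^'m)"
  by (rule linearI) (simp_all add: column_def vec_eq_iff)

lemma ereal_norm_ball_cases:
  "{u :: 'a::real_normed_vector. ereal (norm u) \<le> \<tau>} \<in> insert UNIV (insert {} (range (cball 0)))"
  by (cases \<tau>) auto

lemma isCont_column: "isCont (column i) (U :: real^'n^'m)"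
  using linear_column linear_continuous_at linear_conv_bounded_linear by blast

text \<open>The set is an intersection of preimages of norm balls and of \<open>{0}\<close> under
  the continuous linear column maps.\<close>

lemma
  assumes "0 \<le> \<tau>"
  shows closed_restricted_column_ball: "closed (restricted_column_ball \<tau> I :: (real^'d^'p) set)"
    and convex_restricted_column_ball: "convex (restricted_column_ball \<tau> I :: (real^'d^'p) set)"
proof -
  let ?B = "{u :: real^'p. ereal (norm u) \<le> \<tau>}"
  have eq: "restricted_column_ball \<tau> I
      = (\<Inter>i. column i -` ?B) \<inter> (\<Inter>i\<in>-I. column i -` {0 :: real^'p})"
    using assms by (auto simp: restricted_column_ball_eq column_ball_def)
  have "closed ?B" "convex ?B" using ereal_norm_ball_cases[of \<tau>, where ?'a = "real^'p"] by auto
  then show "closed (restricted_column_ball \<tau> I :: (real^'d^'p) set)"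
    unfolding eq by (intro closed_Int closed_INT ballI continuous_closed_vimage isCont_column) auto
  show "convex (restricted_column_ball \<tau> I :: (real^'d^'p) set)"
    unfolding eq using \<open>convex ?B\<close>
    by (intro convex_Int convex_INT convex_linear_vimage linear_column) auto
qed

lemma
  assumes "\<forall>i j. \<kappa>1 i j \<le> 0" and "\<forall>i j. 0 \<le> \<kappa>2 i j"
  shows closed_restricted_entry_box: "closed (restricted_entry_box \<kappa>1 \<kappa>2 J :: (real^'n^'m) set)"
    and convex_restricted_entry_box: "convex (restricted_entry_box \<kappa>1 \<kappa>2 J :: (real^'n^'m) set)"
proof -
  let ?B = "\<lambda>i j. {s. \<kappa>1 i j \<le> ereal s \<and> ereal s \<le> \<kappa>2 i j}"
  let ?e = "\<lambda>i j S. (S :: real^'n^'m) $ i $ j"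
  have eq: "restricted_entry_box \<kappa>1 \<kappa>2 J
      = (\<Inter>i j. ?e i j -` ?B i j) \<inter> (\<Inter>q\<in>-J. ?e (fst q) (snd q) -` {0})"
    using assms by (auto simp: restricted_entry_box_eq entry_box_def subset_eq) blast
  have "closed (?B i j)" for i j
    by (cases "\<kappa>1 i j"; cases "\<kappa>2 i j") (auto intro!: closed_Collect_conj closed_Collect_le continuous_intros)
  then show "closed (restricted_entry_box \<kappa>1 \<kappa>2 J :: (real^'n^'m) set)"
    unfolding eq
    by (intro closed_Int closed_INT ballI continuous_closed_vimage continuous_intros) auto
  have "convex (?B i j)" for i j
    unfolding is_interval_convex_1[symmetric] is_interval_1
    by (auto intro: order_trans[of _ "ereal _"] order_trans[of "ereal _" "ereal _"])
  moreover have "linear (?e i j)" for i j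
    by (rule linearI) simp_all
  ultimately show "convex (restricted_entry_box \<kappa>1 \<kappa>2 J :: (real^'n^'m) set)"
    unfolding eq by (intro convex_Int convex_INT convex_linear_vimage) auto
qed

text \<open>Near a given point the support can only grow, so the weighted cardinality is unchanged exactly
  on the restricted set and otherwise jumps by at least the weight.\<close>

lemma weighted_card_gap:
  assumes "finite B" and "A \<subseteq> B" and "0 \<le> (c::real)"
  shows "c * card A \<le> c * card B"
    and "B \<subseteq> (if c > 0 then A else UNIV) \<or> c > 0 \<and> c * card A + c \<le> c * card B"
proof -
  show "c * card A \<le> c * card B"
    using assms by (simp add: card_mono mult_left_mono)
  \<comment> \<open>A proper superset has at least one more element, which costs a full
    \<open>c\<close>.\<close>
  have "c * card A + c \<le> c * card B" if "\<not> B \<subseteq> A"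
  proof -
    have "A \<subset> B" using that assms(2) by blast
    then have "Suc (card A) \<le> card B" using assms(1) by (simp add: psubset_card_mono Suc_le_eq)
    then have "c * (1 + card A) \<le> c * card B" using assms(3) by (intro mult_left_mono) auto
    then show ?thesis by (simp add: algebra_simps)
  qed
  then show "B \<subseteq> (if c > 0 then A else UNIV) \<or> c > 0 \<and> c * card A + c \<le> c * card B" by auto
qed

section \<open>Penalty gaps near a given point\<close>

text \<open>Each nonzero column stays nonzero nearby by continuity, and there are finitely many, so
  one neighbourhood serves all. There the support contains the old one and
  \<open>weighted_card_gap\<close> applies.\<close>

lemma nnzc_gap:
  assumes "0 \<le> (lam::real)" and "0 \<le> \<tau>"
  shows "\<forall>\<^sub>F U' in nhds (U :: real^'d^'p). U' \<in> column_ball \<tau> \<longrightarrow>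
    lam * nnzc U \<le> lam * nnzc U' \<and>
    (U' \<in> restricted_column_ball \<tau> (col_index_set lam U) \<or> lam > 0 \<and> lam * nnzc U + lam \<le> lam * nnzc U')"
proof -
  have "\<forall>\<^sub>F U' in nhds U. \<forall>i\<in>{i. column i U \<noteq> 0}. column i U' \<noteq> 0"
    using isCont_tendsto_compose[OF isCont_column filterlim_ident]
    by (intro eventually_ball_finite) (auto intro: tendsto_imp_eventually_ne)
  then show ?thesis
  proof eventually_elim
    case (elim U')
    then have "{i. column i U \<noteq> 0} \<subseteq> {i. column i U' \<noteq> 0}" by auto
    then show ?case
      using weighted_card_gap[of "{i. column i U' \<noteq> 0}" "{i. column i U \<noteq> 0}" lam] assms
      by (auto simp: nnzc_def restricted_column_ball_eq col_index_set_def)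
  qed
qed

lemma l0_norm_gap:
  assumes "0 \<le> (\<beta>::real)" and "\<forall>i j. \<kappa>1 i j \<le> 0" and "\<forall>i j. 0 \<le> \<kappa>2 i j"
  shows "\<forall>\<^sub>F S' in nhds (S :: real^'n^'m). S' \<in> entry_box \<kappa>1 \<kappa>2 \<longrightarrow>
    \<beta> * l0_norm S \<le> \<beta> * l0_norm S' \<and>
    (S' \<in> restricted_entry_box \<kappa>1 \<kappa>2 (entry_index_set \<beta> S) \<or> \<beta> > 0 \<and> \<beta> * l0_norm S + \<beta> \<le> \<beta> * l0_norm S')"
proof -
  have "\<forall>\<^sub>F S' in nhds S. S' $ fst q $ snd q \<noteq> 0" if "S $ fst q $ snd q \<noteq> 0" for q
    using that by (intro tendsto_imp_eventually_ne[of _ "S $ fst q $ snd q"] tendsto_intros filterlim_ident)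
  then have "\<forall>\<^sub>F S' in nhds S. \<forall>q\<in>{(i, j). S $ i $ j \<noteq> 0}. S' $ fst q $ snd q \<noteq> 0"
    by (intro eventually_ball_finite) auto
  then show ?thesis
  proof eventually_elim
    case (elim S')
    then have "{(i, j). S $ i $ j \<noteq> 0} \<subseteq> {(i, j). S' $ i $ j \<noteq> 0}" by auto
    then show ?case
      using weighted_card_gap[of "{(i, j). S' $ i $ j \<noteq> 0}" "{(i, j). S $ i $ j \<noteq> 0}" \<beta>] assms
      by (auto simp: l0_norm_def restricted_entry_box_eq entry_index_set_def)
  qed
qed

section \<open>The factorised problem\<close>

lemma bounded_bilinear_matrix_mult:
  "bounded_bilinear ((**) :: real^'n^'m \<Rightarrow> real^'p^'n \<Rightarrow> real^'p^'m)"
  unfolding bilinear_conv_bounded_bilinear[symmetric] bilinear_def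
  by (auto intro!: linearI simp: matrix_matrix_mult_def vec_eq_iff algebra_simps sum.distrib sum_distrib_left)

lemma bounded_linear_transpose: "bounded_linear (transpose :: real^'n^'m \<Rightarrow> real^'m^'n)"
  unfolding linear_conv_bounded_linear[symmetric]
  by (rule linearI) (simp_all add: transpose_def vec_eq_iff)

text \<open>The adjoint of the map from \<open>A\<close> to \<open>A ** transpose B\<close>; it
  turns the multiplier for the product into a gradient with respect to the first factor.\<close>

lemma inner_matrix_mult_left: "(H :: real^'n^'m) \<bullet> (A ** transpose B) = (H ** B) \<bullet> A"
proof -
  have "(\<Sum>j\<in>UNIV. \<Sum>k\<in>UNIV. H $ i $ j * (A $ i $ k * B $ j $ k))
      = (\<Sum>k\<in>UNIV. \<Sum>j\<in>UNIV. H $ i $ j * (A $ i $ k * B $ j $ k))" for i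
    by (rule sum.swap)
  then show ?thesis
    by (simp add: inner_vec_def matrix_matrix_mult_def transpose_def sum_distrib_left sum_distrib_right mult_ac)
qed

lemma inner_transpose: "transpose (A :: real^'n^'m) \<bullet> transpose B = A \<bullet> B"
  by (simp add: inner_vec_def transpose_def) (rule sum.swap)

lemma inner_matrix_mult_right: "(H :: real^'n^'m) \<bullet> (A ** transpose B) = (transpose H ** A) \<bullet> B"
  using inner_matrix_mult_left[of "transpose H" B A] inner_transpose[of H "A ** transpose B"]
  by (simp add: matrix_transpose_mul)

lemma factor_derivative:
  fixes x :: "(real^'d^'m) \<times> (real^'d^'n) \<times> (real^'n^'m)"
  shows "((\<lambda>(X, Y, S). (X ** transpose Y, S)) has_derivative
    (\<lambda>(A, B, C). (fst x ** transpose B + A ** transpose (fst (snd x)), C))) (at x)"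
  unfolding case_prod_beta
  by (rule derivative_eq_intros bounded_bilinear.FDERIV[OF bounded_bilinear_matrix_mult]
      bounded_linear.has_derivative[OF bounded_linear_transpose] refl)+

section \<open>Equal column supports at global minimizers\<close>

text \<open>Cutting both factors to their common support keeps the product, as every dropped
  rank-one term has a zero factor. Minimality then forbids that any nonzero column was
  dropped.\<close>

lemma global_minimizer_col_index_set:
  fixes X :: "real^'d^'m" and Y :: "real^'d^'n"
  assumes "0 \<le> \<tau>"
    and min: "is_arg_min (FB_objective f lam \<beta>) (\<lambda>p. p \<in> FB_feasible \<tau> \<kappa>1 \<kappa>2) (X, Y, S)"
  shows "col_index_set lam X = col_index_set lam Y"
proof (cases "lam > 0")
  case True
  let ?I = "{i. column i X \<noteq> 0} \<inter> {i. column i Y \<noteq> 0}"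
  let ?X = "zero_cols_outside ?I X" and ?Y = "zero_cols_outside ?I Y"
  have entry: "X $ i $ k = 0 \<or> Y $ j $ k = 0" if "k \<notin> ?I" for i j k
    using that by (auto simp: column_def vec_eq_iff)
  have "?X ** transpose ?Y = X ** transpose Y"
    using entry by (auto simp: vec_eq_iff matrix_matrix_mult_def transpose_def zero_cols_outside_def intro!: sum.cong)
  moreover have "(?X, ?Y, S) \<in> FB_feasible \<tau> \<kappa>1 \<kappa>2"
    using min zero_cols_outside_in_column_ball[OF assms(1), of X ?I]
      zero_cols_outside_in_column_ball[OF assms(1), of Y ?I] by (simp add: is_arg_min_def FB_feasible_def)
  then have "FB_objective f lam \<beta> (X, Y, S) \<le> FB_objective f lam \<beta> (?X, ?Y, S)"
    using min by (auto simp: is_arg_min_linorder)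
  ultimately have "lam * (real (nnzc X) + real (nnzc Y)) \<le> lam * (real (nnzc ?X) + real (nnzc ?Y))"
    by (simp add: FB_objective_def)
  then have "nnzc X + nnzc Y \<le> nnzc ?X + nnzc ?Y" using True by simp
  moreover have "{i. column i ?X \<noteq> 0} = ?I" "{i. column i ?Y \<noteq> 0} = ?I"
    by (auto simp: column_zero_cols_outside)
  moreover have "card ?I \<le> nnzc X" "card ?I \<le> nnzc Y"
    unfolding nnzc_def by (intro card_mono; simp)+
  \<comment> \<open>Neither count can increase, while their sum does not decrease, so both are
    unchanged.\<close>
  ultimately have "card ?I = card {i. column i X \<noteq> 0}" "card ?I = card {i. column i Y \<noteq> 0}"
    by (simp_all add: nnzc_def)
  then have "?I = {i. column i X \<noteq> 0}" "?I = {i. column i Y \<noteq> 0}"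
    by (intro card_subset_eq; simp)+
  then show ?thesis by (simp add: col_index_set_def)
qed (simp add: col_index_set_def)

section \<open>Equivalence of the two local minimization problems\<close>

lemma weighted_nnzc_restricted_le:
  assumes "0 \<le> \<tau>" and "U' \<in> restricted_column_ball \<tau> (col_index_set lam U)" and "0 \<le> lam"
  shows "lam * nnzc U' \<le> lam * nnzc U"
  using assms
  by (auto simp: restricted_column_ball_eq col_index_set_def nnzc_def intro!: card_mono split: if_splits)

lemma weighted_l0_norm_restricted_le:
  assumes "\<forall>i j. \<kappa>1 i j \<le> 0" and "\<forall>i j. 0 \<le> \<kappa>2 i j"
    and "S' \<in> restricted_entry_box \<kappa>1 \<kappa>2 (entry_index_set \<beta> S)" and "0 \<le> \<beta>"
  shows "\<beta> * l0_norm S' \<le> \<beta> * l0_norm S"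
  using assms
  by (auto simp: restricted_entry_box_eq entry_index_set_def l0_norm_def intro!: card_mono split: if_splits)

lemma FB_local_minimizer_iff:
  fixes f :: "(real^'n^'m) \<times> (real^'n^'m) \<Rightarrow> real" and X :: "real^'d^'m" and Y :: "real^'d^'n"
  assumes lip: "locally_lipschitz f" and lam: "0 \<le> lam" and \<beta>: "0 \<le> \<beta>" and \<tau>: "0 \<le> \<tau>"
    and \<kappa>: "\<forall>i j. \<kappa>1 i j \<le> 0" "\<forall>i j. 0 \<le> \<kappa>2 i j"
  shows "local_minimizer_on (FB_objective f lam \<beta>) (FB_feasible \<tau> \<kappa>1 \<kappa>2) (X, Y, S) \<longleftrightarrow>
    local_minimizer_on (\<lambda>(X, Y, S). f (X ** transpose Y, S))
      (restricted_column_ball \<tau> (col_index_set lam X) \<times> restricted_column_ball \<tau> (col_index_set lam Y)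
        \<times> restricted_entry_box \<kappa>1 \<kappa>2 (entry_index_set \<beta> S)) (X, Y, S)"
    (is "local_minimizer_on ?F ?\<Omega> ?p \<longleftrightarrow> local_minimizer_on ?g ?R ?p")
proof -
  have RsubF: "?R \<subseteq> ?\<Omega>"
    using \<tau> \<kappa> by (auto simp: FB_feasible_def restricted_column_ball_eq restricted_entry_box_eq)
  \<comment> \<open>Every matrix is supported on its own index set, so membership of the centre is
    the same condition for both sets.\<close>
  have memR: "?p \<in> ?\<Omega> \<longleftrightarrow> ?p \<in> ?R"
    using \<tau> \<kappa> by (auto simp: FB_feasible_def restricted_column_ball_eq restricted_entry_box_eq
        col_index_set_def entry_index_set_def)
  \<comment> \<open>On \<open>?R\<close> the penalty is at most its value at \<open>?p\<close>, so
    the inequality for \<open>?F\<close> passes to \<open>?g\<close>.\<close>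
  have "\<forall>\<^sub>F y in nhds ?p. y \<in> ?R \<longrightarrow> ?g ?p \<le> ?g y"
    if "\<forall>\<^sub>F y in nhds ?p. y \<in> ?\<Omega> \<longrightarrow> ?F ?p \<le> ?F y"
    using that
  proof eventually_elim
    case (elim y)
    obtain X' Y' S' where y: "y = (X', Y', S')" by (cases y)
    show ?case
    proof
      assume "y \<in> ?R"
      then have R: "X' \<in> restricted_column_ball \<tau> (col_index_set lam X)"
        "Y' \<in> restricted_column_ball \<tau> (col_index_set lam Y)"
        "S' \<in> restricted_entry_box \<kappa>1 \<kappa>2 (entry_index_set \<beta> S)" by (auto simp: y)
      have "?F ?p \<le> ?F y" using elim \<open>y \<in> ?R\<close> RsubF by blast
      then show "?g ?p \<le> ?g y"
        using weighted_nnzc_restricted_le[OF \<tau> R(1) lam] weighted_nnzc_restricted_le[OF \<tau> R(2) lam]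
          weighted_l0_norm_restricted_le[OF \<kappa> R(3) \<beta>]
        by (simp add: y FB_objective_def algebra_simps)
    qed
  qed
  moreover have "\<forall>\<^sub>F y in nhds ?p. y \<in> ?\<Omega> \<longrightarrow> ?F ?p \<le> ?F y"
    if "\<forall>\<^sub>F y in nhds ?p. y \<in> ?R \<longrightarrow> ?g ?p \<le> ?g y"
  proof -
    have fst: "filterlim fst (nhds X) (nhds ?p)"
      and snd1: "filterlim (\<lambda>y. fst (snd y)) (nhds Y) (nhds ?p)"
      and snd2: "filterlim (\<lambda>y. snd (snd y)) (nhds S) (nhds ?p)"
      using tendsto_fst[OF filterlim_ident, of "?p"] tendsto_fst[OF tendsto_snd[OF filterlim_ident], of "?p"]
        tendsto_snd[OF tendsto_snd[OF filterlim_ident], of "?p"] by simp_all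
    have "isCont (\<lambda>y. f (fst y ** transpose (fst (snd y)), snd (snd y))) ?p"
      using isCont_o2[OF has_derivative_continuous[OF factor_derivative] locally_lipschitz_continuous[OF lip]]
      by (simp add: case_prod_beta)
    from isCont_tendsto_compose[OF this filterlim_ident]
    have lim: "filterlim ?g (nhds (?g ?p)) (nhds ?p)"
      unfolding case_prod_beta by simp
    \<comment> \<open>Near \<open>?p\<close> the smooth part drops by less than the weight. The
      value \<open>1\<close> is only a positive placeholder for a zero weight, where no jump case
      arises.\<close>
    have low: "\<forall>\<^sub>F y in nhds ?p. ?g ?p - (if c > 0 then c else 1) < ?g y" for c :: real
      by (rule order_tendstoD(1)[OF lim]) simp
    show ?thesis
      using that low[of lam] low[of \<beta>]
        filterlim_iff[THEN iffD1, OF fst, rule_format, OF nnzc_gap[OF lam \<tau>]]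
        filterlim_iff[THEN iffD1, OF snd1, rule_format, OF nnzc_gap[OF lam \<tau>]]
        filterlim_iff[THEN iffD1, OF snd2, rule_format, OF l0_norm_gap[OF \<beta> \<kappa>]]
    proof eventually_elim
      case (elim y)
      obtain X' Y' S' where y: "y = (X', Y', S')" by (cases y)
      show ?case
      proof
        assume "y \<in> ?\<Omega>"
        then have mem: "X' \<in> column_ball \<tau>" "Y' \<in> column_ball \<tau>" "S' \<in> entry_box \<kappa>1 \<kappa>2"
          by (auto simp: y FB_feasible_def)
        have X': "lam * nnzc X \<le> lam * nnzc X'"
            "X' \<in> restricted_column_ball \<tau> (col_index_set lam X) \<or> lam > 0 \<and> lam * nnzc X + lam \<le> lam * nnzc X'"
          using elim(4) mem(1) unfolding y fst_conv by blast+
        have Y': "lam * nnzc Y \<le> lam * nnzc Y'"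
            "Y' \<in> restricted_column_ball \<tau> (col_index_set lam Y) \<or> lam > 0 \<and> lam * nnzc Y + lam \<le> lam * nnzc Y'"
          using elim(5) mem(2) unfolding y fst_conv snd_conv by blast+
        have S': "\<beta> * l0_norm S \<le> \<beta> * l0_norm S'"
            "S' \<in> restricted_entry_box \<kappa>1 \<kappa>2 (entry_index_set \<beta> S) \<or> \<beta> > 0 \<and> \<beta> * l0_norm S + \<beta> \<le> \<beta> * l0_norm S'"
          using elim(6) mem(3) unfolding y snd_conv by blast+
        have F: "?F (A, B, C) = ?g (A, B, C) + lam * nnzc A + lam * nnzc B + \<beta> * l0_norm C" for A B C
          by (simp add: FB_objective_def algebra_simps)
        \<comment> \<open>Outside \<open>?R\<close> some support has grown, and the penalty rises by
          a full positive weight, more than \<open>?g\<close> can drop.\<close>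
        consider "y \<in> ?R" | "lam > 0" "lam * nnzc X + lam \<le> lam * nnzc X'"
          | "lam > 0" "lam * nnzc Y + lam \<le> lam * nnzc Y'"
          | "\<beta> > 0" "\<beta> * l0_norm S + \<beta> \<le> \<beta> * l0_norm S'"
          using X'(2) Y'(2) S'(2) unfolding y by blast
        then show "?F ?p \<le> ?F y"
        proof cases
          case 1
          then have "?g ?p \<le> ?g y" using elim(1) by blast
          then show ?thesis unfolding y F using X'(1) Y'(1) S'(1) by linarith
        next
          case 2
          then have "?g ?p - lam < ?g y" using elim(2) by simp
          then show ?thesis unfolding y F using 2 Y'(1) S'(1) by linarith
        next
          case 3
          then have "?g ?p - lam < ?g y" using elim(2) by simp
          then show ?thesis unfolding y F using 3 X'(1) S'(1) by linarith
        next
          case 4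
          then have "?g ?p - \<beta> < ?g y" using elim(3) by simp
          then show ?thesis unfolding y F using 4 X'(1) Y'(1) by linarith
        qed
      qed
    qed
  qed
  ultimately show ?thesis unfolding local_minimizer_on_eventually using memR by blast
qed

section \<open>Multipliers for the factorised problem\<close>

lemma zero_in_elt_set_plus: "0 \<in> v +o A \<longleftrightarrow> - v \<in> (A :: 'a::ab_group_add set)"
  by (auto simp: elt_set_plus_def add_eq_0_iff)

text \<open>\<open>composite_multiplier\<close> on the product set gives one joint variational
  inequality. Moving a single block at a time splits it into three, and the adjoint identities read
  off the normals.\<close>

lemma FB_multiplier:
  fixes f :: "(real^'n^'m) \<times> (real^'n^'m) \<Rightarrow> real" and X :: "real^'d^'m" and Y :: "real^'d^'n"
  assumes lip: "locally_lipschitz f" and \<tau>: "0 \<le> \<tau>"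
    and \<kappa>: "\<forall>i j. \<kappa>1 i j \<le> 0" "\<forall>i j. 0 \<le> \<kappa>2 i j"
    and min: "local_minimizer_on (\<lambda>(X, Y, S). f (X ** transpose Y, S))
      (restricted_column_ball \<tau> I \<times> restricted_column_ball \<tau> I' \<times> restricted_entry_box \<kappa>1 \<kappa>2 J) (X, Y, S)"
      (is "local_minimizer_on _ (?\<Omega>X \<times> ?\<Omega>Y \<times> ?\<Omega>S) _")
  obtains H\<^sub>Z H\<^sub>S where "(H\<^sub>Z, H\<^sub>S) \<in> limiting_subdifferential f (X ** transpose Y, S)"
    "- (H\<^sub>Z ** Y) \<in> limiting_normal_cone ?\<Omega>X X"
    "- (transpose H\<^sub>Z ** X) \<in> limiting_normal_cone ?\<Omega>Y Y"
    "- H\<^sub>S \<in> limiting_normal_cone ?\<Omega>S S"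
proof -
  let ?G = "\<lambda>(X :: real^'d^'m, Y :: real^'d^'n, S :: real^'n^'m). (X ** transpose Y, S)"
  let ?G' = "\<lambda>x :: (real^'d^'m) \<times> (real^'d^'n) \<times> (real^'n^'m).
    \<lambda>(A, B, C). (fst x ** transpose B + A ** transpose (fst (snd x)), C)"
  have "closed (?\<Omega>X \<times> ?\<Omega>Y \<times> ?\<Omega>S)"
    by (intro closed_Times closed_restricted_column_ball closed_restricted_entry_box \<tau> \<kappa>)
  moreover have "convex (?\<Omega>X \<times> ?\<Omega>Y \<times> ?\<Omega>S)"
    by (intro convex_Times convex_restricted_column_ball convex_restricted_entry_box \<tau> \<kappa>)
  moreover have "continuous_on UNIV (\<lambda>(x, h). ?G' x h)"
    unfolding case_prod_beta
    by (intro continuous_intros bounded_bilinear.continuous_on[OF bounded_bilinear_matrix_mult]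
        bounded_linear.continuous_on[OF bounded_linear_transpose])
  moreover have "local_minimizer_on (\<lambda>x. f (?G x)) (?\<Omega>X \<times> ?\<Omega>Y \<times> ?\<Omega>S) (X, Y, S)"
    using min unfolding case_prod_beta by simp
  ultimately obtain H where H: "H \<in> limiting_subdifferential f (?G (X, Y, S))"
    and vi: "\<And>y. y \<in> ?\<Omega>X \<times> ?\<Omega>Y \<times> ?\<Omega>S \<Longrightarrow> 0 \<le> H \<bullet> ?G' (X, Y, S) (y - (X, Y, S))"
    using composite_multiplier[OF _ _ lip factor_derivative] by blast
  obtain H\<^sub>Z H\<^sub>S where H_eq: "H = (H\<^sub>Z, H\<^sub>S)" by (cases H)
  have mem: "X \<in> ?\<Omega>X" "Y \<in> ?\<Omega>Y" "S \<in> ?\<Omega>S"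
    using min by (auto simp: local_minimizer_on_def)
  have zero: "A ** transpose (0 :: real^'d^'n) = 0" "(0 :: real^'d^'m) ** transpose B = 0"
    for A :: "real^'d^'m" and B :: "real^'d^'n"
    by (simp_all add: matrix_matrix_mult_def transpose_def vec_eq_iff)
  \<comment> \<open>With only the first block moved, the derivative reduces to
    \<open>(X' - X) ** transpose Y\<close>.\<close>
  have "0 \<le> (H\<^sub>Z ** Y) \<bullet> (X' - X)" if "X' \<in> ?\<Omega>X" for X'
    using vi[of "(X', Y, S)"] that mem by (simp add: H_eq inner_prod_def case_prod_beta zero inner_matrix_mult_left)
  moreover have "0 \<le> (transpose H\<^sub>Z ** X) \<bullet> (Y' - Y)" if "Y' \<in> ?\<Omega>Y" for Y'
    using vi[of "(X, Y', S)"] that mem by (simp add: H_eq inner_prod_def case_prod_beta zero inner_matrix_mult_right)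
  moreover have "0 \<le> H\<^sub>S \<bullet> (S' - S)" if "S' \<in> ?\<Omega>S" for S'
    using vi[of "(X, Y, S')"] that mem by (simp add: H_eq inner_prod_def case_prod_beta zero)
  ultimately show thesis
    using that H mem by (simp add: H_eq limiting_normalI)
qed

theorem proposition4:
  fixes f :: "(real^'n^'m) \<times> (real^'n^'m) \<Rightarrow> real"
    and lam \<beta> :: real
    and \<tau> :: ereal
    and \<kappa>1 \<kappa>2 :: "'m \<Rightarrow> 'n \<Rightarrow> ereal"
  assumes "\<forall>p. 0 \<le> f p"
    and "locally_lipschitz f"
    and "0 \<le> lam" and "0 \<le> \<beta>" and "0 \<le> \<tau>"
    and "\<forall>i j. \<kappa>1 i j \<le> 0" and "\<forall>i j. 0 \<le> \<kappa>2 i j"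
  shows
    "(\<forall>(X::real^'d^'m) (Y::real^'d^'n) S.
        is_arg_min (FB_objective f lam \<beta>) (\<lambda>p. p \<in> FB_feasible \<tau> \<kappa>1 \<kappa>2) (X, Y, S) \<longrightarrow>
        col_index_set lam X = col_index_set lam Y)
     \<and>
     (\<forall>(X::real^'d^'m) (Y::real^'d^'n) S.
        local_minimizer_on (FB_objective f lam \<beta>) (FB_feasible \<tau> \<kappa>1 \<kappa>2) (X, Y, S) \<longleftrightarrow>
        local_minimizer_on (\<lambda>(X, Y, S). f (X ** transpose Y, S))
          (restricted_column_ball \<tau> (col_index_set lam X)
             \<times> restricted_column_ball \<tau> (col_index_set lam Y)
             \<times> restricted_entry_box \<kappa>1 \<kappa>2 (entry_index_set \<beta> S))
          (X, Y, S))
     \<and>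
     (\<forall>(X::real^'d^'m) (Y::real^'d^'n) S.
        local_minimizer_on (FB_objective f lam \<beta>) (FB_feasible \<tau> \<kappa>1 \<kappa>2) (X, Y, S) \<longrightarrow>
        (\<exists>H\<^sub>Z H\<^sub>S. (H\<^sub>Z, H\<^sub>S) \<in> limiting_subdifferential f (X ** transpose Y, S) \<and>
           0 \<in> (H\<^sub>Z ** Y) +o
             limiting_normal_cone (restricted_column_ball \<tau> (col_index_set lam X)) X \<and>
           0 \<in> (transpose H\<^sub>Z ** X) +o
             limiting_normal_cone (restricted_column_ball \<tau> (col_index_set lam Y)) Y \<and>
           0 \<in> H\<^sub>S +o
             limiting_normal_cone (restricted_entry_box \<kappa>1 \<kappa>2 (entry_index_set \<beta> S)) S))"
proof (intro conjI allI impI)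
  fix X :: "real^'d^'m" and Y :: "real^'d^'n" and S
  show "col_index_set lam X = col_index_set lam Y"
    if "is_arg_min (FB_objective f lam \<beta>) (\<lambda>p. p \<in> FB_feasible \<tau> \<kappa>1 \<kappa>2) (X, Y, S)"
    using assms(5) that by (rule global_minimizer_col_index_set)
next
  fix X :: "real^'d^'m" and Y :: "real^'d^'n" and S
  note iff = FB_local_minimizer_iff[OF assms(2-7), of X Y S]
  show "local_minimizer_on (FB_objective f lam \<beta>) (FB_feasible \<tau> \<kappa>1 \<kappa>2) (X, Y, S) \<longleftrightarrow>
    local_minimizer_on (\<lambda>(X, Y, S). f (X ** transpose Y, S))
      (restricted_column_ball \<tau> (col_index_set lam X)
         \<times> restricted_column_ball \<tau> (col_index_set lam Y)
         \<times> restricted_entry_box \<kappa>1 \<kappa>2 (entry_index_set \<beta> S))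
      (X, Y, S)"
    by (rule iff)
  assume "local_minimizer_on (FB_objective f lam \<beta>) (FB_feasible \<tau> \<kappa>1 \<kappa>2) (X, Y, S)"
  then show "\<exists>H\<^sub>Z H\<^sub>S. (H\<^sub>Z, H\<^sub>S) \<in> limiting_subdifferential f (X ** transpose Y, S) \<and>
      0 \<in> (H\<^sub>Z ** Y) +o limiting_normal_cone (restricted_column_ball \<tau> (col_index_set lam X)) X \<and>
      0 \<in> (transpose H\<^sub>Z ** X) +o limiting_normal_cone (restricted_column_ball \<tau> (col_index_set lam Y)) Y \<and>
      0 \<in> H\<^sub>S +o limiting_normal_cone (restricted_entry_box \<kappa>1 \<kappa>2 (entry_index_set \<beta> S)) S"
    unfolding zero_in_elt_set_plus iff by (rule FB_multiplier[OF assms(2,5-7)]) blast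
qed

end
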